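(* Let $P(s)$ and $C(s)$ be real rational (not necessarily proper) functions. For each $N\in\mathbb{N}$ let $$S_N(s)=\left[(I+P(s)C(s)L_N)^{-1}\right]_{1,1},$$ where $L_N\in\mathbb{R}^{N\times N}$ is the tridiagonal matrix defined in the context. If $$\frac{1}{1+kP(s)C(s)}\in\mathscr{H}_\infty\quad\text{for all } k\in(0,4),$$ then $S_N(s)\in\mathscr{H}_\infty$ for all $N\in\mathbb{N}$. If in addition $P(s)C(s)$ has at least two more poles than zeros, then $$\int_0^\infty \ln|S_N(j\omega)|\,d\omega=0\quad\text{for all } N\in\mathbb{N}.$$
   Context: $\mathbb{N}=\{1,2,3,\dots\}$; $j$ is the imaginary unit; $\mathbb{C}_+=\{s\in\mathbb{C}:\mathrm{Re}(s)>0\}$. $[A]_{1,1}$ is the $(1,1)$ entry of a matrix $A$, and $I$ is the identity matrix. For $N\in\mathbb{N}$, $L_N=B_N^TB_N$, where $B_N\in\mathbb{R}^{N\times N}$ is the upper bidiagonal matrix with $1$ in every diagonal entry, $-1$ in every entry of the first superdiagonal, and $0$ elsewhere. Equivalently, $L_N$ is the symmetric tridiagonal matrix with $(1,1)$ entry equal to $1$, all other diagonal entries equal to $2$, all entries of the first super- and subdiagonals equal to $-1$, and all other entries $0$ (so $L_1=[1]$). $S_N(s)$ is a rational function of $s$ (the inverse is taken over the field of rational functions). $\mathscr{H}_\infty$ is the Hardy space of functions $G$ analytic on $\mathbb{C}_+$ with $\|G(s)\|_\infty=\sup_{s\in\mathbb{C}_+}|G(s)|<\infty$; a rational function belongs to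 $\mathscr{H}_\infty$ exactly when it is proper and has no poles in the closed right half plane. "$P(s)C(s)$ has at least two more poles than zeros" refers to finite poles and zeros counted with multiplicity, i.e. when the product $P(s)C(s)$ is written as a ratio of coprime polynomials, the degree of the denominator exceeds the degree of the numerator by at least $2$. *)

theory Defs
  imports
    "HOL-Analysis.Analysis"
    "HOL-Computational_Algebra.Computational_Algebra"
    "HOL-Computational_Algebra.Field_as_Ring"
    "Jordan_Normal_Form.Gauss_Jordan_Elimination"
begin

type_synonym real_ratfun = "real poly fract"

definition ratfun_const :: "real \<Rightarrow> real_ratfun" where
  "ratfun_const c = to_fract [:c:]"

abbreviation ratfun_num :: "real_ratfun \<Rightarrow> real poly" where
  "ratfun_num f \<equiv> fst (quot_of_fract f)"

abbreviation ratfun_denom :: "real_ratfun \<Rightarrow> real poly" where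
  "ratfun_denom f \<equiv> snd (quot_of_fract f)"

text \<open>
  \<^const>\<open>quot_of_fract\<close> returns a coprime pair, so removable singularities are
  evaluated at their limit. At a pole the value is \<open>0\<close> because of division by zero; near a
  pole the function is still unbounded, so a rational function with a pole in the open right
  half plane is not in the Hardy space below.
\<close>
definition ratfun_eval :: "real_ratfun \<Rightarrow> complex \<Rightarrow> complex" where
  "ratfun_eval f s =
     poly (map_poly of_real (ratfun_num f)) s / poly (map_poly of_real (ratfun_denom f)) s"

definition Hinf :: "(complex \<Rightarrow> complex) set" where
  "Hinf = {G. G analytic_on {s. Re s > 0} \<and> bounded (G ` {s. Re s > 0})}"

definition B_mat :: "nat \<Rightarrow> real mat" where
  "B_mat N = Matrix.mat N N (\<lambda>(i, j). if i = j then 1 else if j = Suc i then -1 else 0)"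

definition L_mat :: "nat \<Rightarrow> real mat" where
  "L_mat N = transpose_mat (B_mat N) * B_mat N"

definition loop_mat :: "real_ratfun \<Rightarrow> real_ratfun \<Rightarrow> nat \<Rightarrow> real_ratfun mat" where
  "loop_mat P C N = 1\<^sub>m N + (P * C) \<cdot>\<^sub>m map_mat ratfun_const (L_mat N)"

text \<open>
  Meaningful only for an invertible matrix: \<^const>\<open>mat_inverse\<close> returns \<^const>\<open>None\<close>
  otherwise. Matrix indices start at \<open>0\<close>, so the entry \<open>(0, 0)\<close> is the upper left one.
\<close>
definition S_fun :: "real_ratfun \<Rightarrow> real_ratfun \<Rightarrow> nat \<Rightarrow> real_ratfun" where
  "S_fun P C N = the (mat_inverse (loop_mat P C N)) $$ (0, 0)"

end

theory Submission
  imports Defs "HOL-Real_Asymp.Real_Asymp" "Jordan_Normal_Form.Char_Poly"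
begin

text \<open>
  Write \<open>G = PC = n / d\<close> in lowest terms. The three-term recurrence for the tridiagonal matrix gives
  \<open>S\<^sub>N = det (I + G T) / det (I + G L\<^sub>N)\<close>, where \<open>T\<close> arises from \<open>L\<^sub>N\<close> by deleting the first row
  and column. Substituting \<open>G = -1 / (2 - 2 cos \<theta>)\<close> turns the recurrence into the addition
  theorem for the sine, so both determinants split into factors \<open>1 + c G\<close> with \<open>0 < c < 4\<close>, and
  \<open>S\<^sub>N\<close> is a product of functions \<open>(1 + a G) / (1 + b G) = a / b + (1 - a / b) / (1 + b G)\<close>,
  which lie in the Hardy space by hypothesis.

  The hypothesis also says that \<open>d + k n\<close> has no zeros in the closed right half plane for
  \<open>0 < k < 4\<close>; letting \<open>k\<close> tend to \<open>0\<close>, \<open>d\<close> has none in the open one. If \<open>deg d \<ge> deg n + 2\<close>,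
  numerator and denominator of \<open>S\<^sub>N\<close> therefore have all roots in the closed left half plane and
  agree in their two leading coefficients. A root \<open>z\<close> contributes \<open>- \<pi> Re z\<close>, up to a
  constant, to the integral of \<open>ln |p(i\<omega>)|\<close> over the real line, so the integral of
  \<open>ln |S\<^sub>N(i\<omega>)|\<close> is a multiple of the difference of the sums of the roots, which is zero.
\<close>

section \<open>Logarithmic integrals along the imaginary axis\<close>

text \<open>The fundamental theorem for nonnegative integrands gives integrability and value on the
  open half line; reflection covers the other half, and the point 0 is added back. At 0 only the
  limit of \<open>F\<close> enters, so \<open>f\<close> may be singular there.\<close>

lemma has_bochner_integral_even_nonneg:
  fixes f F :: "real \<Rightarrow> real"
  assumes F: "\<And>x. x > 0 \<Longrightarrow> (F has_real_derivative f x) (at x)"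
    and cont: "\<And>x. x > 0 \<Longrightarrow> isCont f x"
    and nonneg: "\<And>x. x > 0 \<Longrightarrow> f x \<ge> 0"
    and even: "\<And>x. f (- x) = f x"
    and A: "(F \<longlongrightarrow> A) (at_right 0)" and B: "(F \<longlongrightarrow> B) at_top"
  shows "has_bochner_integral lborel f (2 * (B - A))"
proof -
  have A': "((F \<circ> real_of_ereal) \<longlongrightarrow> A) (at_right (ereal 0))"
    unfolding ereal_tendsto_simps using A by simp
  have B': "((F \<circ> real_of_ereal) \<longlongrightarrow> B) (at_left \<infinity>)"
    unfolding ereal_tendsto_simps using B by simp
  note FTC = interval_integral_FTC_nonneg[OF _ _ _ _ A' B', of f]
  have "set_integrable lborel (einterval 0 \<infinity>) f" "(LBINT x=0..\<infinity>. f x) = B - A"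
    using FTC F cont nonneg by (auto simp: zero_ereal_def)
  moreover have "einterval 0 \<infinity> = {0::real<..}"
    by (auto simp: einterval_def)
  ultimately have pos: "has_bochner_integral lborel (\<lambda>x. indicator {0<..} x *\<^sub>R f x) (B - A)"
    by (simp add: has_bochner_integral_iff set_integrable_def set_lebesgue_integral_def
        interval_lebesgue_integral_def)
  have "has_bochner_integral lborel (\<lambda>x. indicator {0<..} (0 + (-1) * x) *\<^sub>R f (0 + (-1) * x))
      ((B - A) /\<^sub>R \<bar>-1\<bar>)"
    using pos by (subst lborel_has_bochner_integral_real_affine_iff[symmetric]) auto
  note sum = has_bochner_integral_add[OF pos this]
  have "has_bochner_integral lborel (\<lambda>x. indicator {0::real} x *\<^sub>R f 0)
      (measure lborel {0::real} *\<^sub>R f 0)"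
    by (intro has_bochner_integral_indicator) auto
  note sum = has_bochner_integral_add[OF sum this]
  have eq: "(\<lambda>x. indicator {0<..} x *\<^sub>R f x + indicator {0<..} (0 + (-1) * x) *\<^sub>R f (0 + (-1) * x)
      + indicator {0} x *\<^sub>R f 0) = f"
    by (auto simp: fun_eq_iff indicator_def even)
  show ?thesis using sum unfolding eq by simp
qed

text \<open>\<open>b\<close> will be the distance of a root from the imaginary axis. Comparison with
  distance 1 makes the integrand decay like 1/u^2. It does not change sign on the positive half
  line, so the rule for nonnegative integrands applies to it or to its negative.\<close>

lemma has_bochner_integral_ln_ratio:
  fixes b :: real
  assumes "b \<ge> 0"
  shows "has_bochner_integral lborel (\<lambda>u. (ln (u\<^sup>2 + b\<^sup>2) - ln (u\<^sup>2 + 1)) / 2) (pi * (b - 1))"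
proof -
  define g where "g = (\<lambda>u. (ln (u\<^sup>2 + b\<^sup>2) - ln (u\<^sup>2 + 1)) / 2)"
  \<comment> \<open>Found by integration by parts. For \<open>b = 0\<close> the term with
    \<open>u / b\<close> vanishes because of the factor \<open>b\<close>.\<close>
  define F where "F = (\<lambda>u. u * (ln (u\<^sup>2 + b\<^sup>2) - ln (u\<^sup>2 + 1)) / 2 + b * arctan (u / b) - arctan u)"
  have pos: "u\<^sup>2 + b\<^sup>2 > 0" "u\<^sup>2 + 1 > 0" if "u > 0" for u
    using that by (auto intro: add_pos_nonneg)
  have F': "(F has_real_derivative g u) (at u)" if "u > 0" for u
  proof -
    define L where "L = (\<lambda>u. ln (u\<^sup>2 + b\<^sup>2) - ln (u\<^sup>2 + 1))"
    define p where "p = u\<^sup>2 + b\<^sup>2"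
    define q where "q = u\<^sup>2 + 1"
    have pq: "p > 0" "q > 0" using pos[OF that] by (auto simp: p_def q_def)
    have L': "(L has_real_derivative 2 * u / p - 2 * u / q) (at u)"
      unfolding L_def p_def q_def using pos[OF that] that
      by (auto intro!: derivative_eq_intros)
    have 1: "((\<lambda>u. u * L u / 2) has_real_derivative (L u + (2 * u / p - 2 * u / q) * u) / 2) (at u)"
      by (auto intro!: derivative_eq_intros L')
    have 2: "((\<lambda>u. b * arctan (u / b)) has_real_derivative b\<^sup>2 / p) (at u)"
    proof (cases "b = 0")
      case False
      have "1 + (u / b)\<^sup>2 = p / b\<^sup>2" using False by (simp add: field_simps p_def)
      with False pq show ?thesis
        by (auto intro!: derivative_eq_intros simp: field_simps power2_eq_square)
    qed simp
    have 3: "(arctan has_real_derivative 1 / q) (at u)"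
      by (auto intro!: derivative_eq_intros simp: q_def field_simps)
    have "(L u + (2 * u / p - 2 * u / q) * u) / 2 + b\<^sup>2 / p - 1 / q
        = L u / 2 + (u\<^sup>2 + b\<^sup>2) / p - (u\<^sup>2 + 1) / q"
      by (simp add: diff_divide_distrib add_divide_distrib algebra_simps power2_eq_square)
    also have "\<dots> = L u / 2 + p / p - q / q" by (simp only: p_def q_def)
    also have "\<dots> = g u" using pq by (simp add: g_def L_def)
    finally have "(L u + (2 * u / p - 2 * u / q) * u) / 2 + b\<^sup>2 / p - 1 / q = g u" .
    from DERIV_cong[OF DERIV_diff[OF DERIV_add[OF 1 2] 3] this] show ?thesis
      by (simp add: F_def L_def)
  qed
  have A: "(F \<longlongrightarrow> 0) (at_right 0)"
  proof (cases "b = 0")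
    case True
    show ?thesis unfolding F_def True by simp real_asymp
  next
    case False
    hence "b > 0" using assms by simp
    then show ?thesis unfolding F_def by real_asymp
  qed
  have B: "(F \<longlongrightarrow> (b - 1) * pi / 2) at_top"
  proof (cases "b = 0")
    case True
    show ?thesis unfolding F_def True by simp (real_asymp simp: field_simps)
  next
    case False
    hence "b > 0" using assms by simp
    then show ?thesis unfolding F_def by (real_asymp simp: field_simps)
  qed
  have cont: "isCont g u" if "u > 0" for u
    unfolding g_def using pos[OF that] by (auto intro!: continuous_intros)
  have even: "g (- u) = g u" for u by (simp add: g_def)
  show ?thesis
  proof (cases "b \<ge> 1")
    case True
    hence "b\<^sup>2 \<ge> 1" by simp
    hence "g u \<ge> 0" if "u > 0" for u
      using pos[OF that] by (auto simp: g_def)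
    from has_bochner_integral_even_nonneg[OF F' cont this even A B]
    show ?thesis by (simp add: g_def[symmetric] mult.commute)
  next
    case False
    hence "b\<^sup>2 \<le> 1" using assms by (simp add: power_le_one)
    hence "- g u \<ge> 0" if "u > 0" for u
      using pos[OF that] by (auto simp: g_def)
    moreover have "((\<lambda>u. - F u) has_real_derivative - g u) (at u)" if "u > 0" for u
      using F'[OF that] by (rule DERIV_minus)
    moreover have "isCont (\<lambda>u. - g u) u" if "u > 0" for u using cont[OF that] by simp
    ultimately have "has_bochner_integral lborel (\<lambda>u. - g u) (2 * (- ((b - 1) * pi / 2) - (- 0)))"
      using A B even
      by (intro has_bochner_integral_even_nonneg[of "\<lambda>u. - F u"]) (auto intro: tendsto_minus simp del: minus_zero)
    from has_bochner_integral_minus[OF this]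
    show ?thesis by (simp add: g_def[symmetric] mult.commute)
  qed
qed

text \<open>The rational term cancels the 1/x part of the logarithms and leaves order 1/x^2, so the
  integral exists; it is zero because the antiderivative \<open>F\<close> has the same limit
  \<open>- a\<close> at both ends.\<close>

lemma has_bochner_integral_ln_shift:
  fixes a :: real
  shows "has_bochner_integral lborel
    (\<lambda>x. (ln ((x - a)\<^sup>2 + 1) - ln (x\<^sup>2 + 1)) / 2 + a * x / (x\<^sup>2 + 1)) 0"
proof -
  define k where "k = (\<lambda>x. (ln ((x - a)\<^sup>2 + 1) - ln (x\<^sup>2 + 1)) / 2 + a * x / (x\<^sup>2 + 1))"
  define F where "F = (\<lambda>x. ((x - a) * ln ((x - a)\<^sup>2 + 1) - x * ln (x\<^sup>2 + 1)) / 2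
      + arctan (x - a) - arctan x + a / 2 * ln (x\<^sup>2 + 1))"
  have pos: "(x - c)\<^sup>2 + 1 > 0" "x\<^sup>2 + 1 > 0" for x c :: real
    by (auto intro: add_nonneg_pos)
  have int1: "integrable lborel (\<lambda>x::real. 1 / (x\<^sup>2 + 1))"
  proof -
    have "has_bochner_integral lborel (\<lambda>x::real. 1 / (x\<^sup>2 + 1)) (2 * (pi / 2 - 0))"
    proof (rule has_bochner_integral_even_nonneg[of arctan])
      show "(arctan has_real_derivative 1 / (x\<^sup>2 + 1)) (at x)" for x
        by (auto intro!: derivative_eq_intros simp: field_simps)
      show "isCont (\<lambda>x::real. 1 / (x\<^sup>2 + 1)) x" for x
        using pos(2)[of x] by (auto intro!: continuous_intros)
      show "(arctan \<longlongrightarrow> 0) (at_right 0)" by real_asymp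
      show "(arctan \<longlongrightarrow> pi / 2) at_top" by (rule tendsto_arctan_at_top)
    qed auto
    thus ?thesis by (simp add: has_bochner_integral_iff)
  qed
  have int2: "integrable lborel (\<lambda>x::real. 1 / ((x - a)\<^sup>2 + 1))"
    using lborel_integrable_real_affine[OF int1, of 1 "-a"] by simp
  \<comment> \<open>Applying \<open>ln t \<le> t - 1\<close> to \<open>p / q\<close> and to
    \<open>q / p\<close> bounds \<open>k\<close> from both sides; the error
    \<open>(p - q)\<^sup>2 / (p * q)\<close> is controlled by
    \<open>(a - 2 * x)\<^sup>2 \<le> 2 * p + 2 * q\<close>.\<close>
  have bound: "\<bar>k x\<bar> \<le> 2 * a\<^sup>2 * (1 / (x\<^sup>2 + 1)) + 2 * a\<^sup>2 * (1 / ((x - a)\<^sup>2 + 1))" for x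
  proof -
    define p where "p = (x - a)\<^sup>2 + 1"
    define q where "q = x\<^sup>2 + 1"
    have p: "p > 0" and q: "q > 0" using pos by (auto simp: p_def q_def)
    have k: "2 * k x = ln (p / q) + 2 * a * x / q"
      using p q by (simp add: k_def p_def[symmetric] q_def[symmetric] ln_div)
    have pq: "p - q = a\<^sup>2 - 2 * a * x" by (simp add: p_def q_def power2_eq_square algebra_simps)
    have "ln (p / q) \<le> p / q - 1" using p q by (intro ln_le_minus_one) auto
    also have "p / q - 1 = (p - q) / q" using q by (simp add: diff_divide_distrib)
    finally have "2 * k x \<le> (p - q) / q + 2 * a * x / q"
      unfolding k by simp
    also have "\<dots> = a\<^sup>2 / q" unfolding pq by (simp add: diff_divide_distrib)
    finally have up: "2 * k x \<le> a\<^sup>2 / q" .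
    have "ln (q / p) \<le> q / p - 1" using p q by (intro ln_le_minus_one) auto
    also have "q / p - 1 = - ((p - q) / p)" using p by (simp add: diff_divide_distrib)
    finally have "ln (p / q) \<ge> (p - q) / p" using p q by (simp add: ln_div)
    moreover have "a\<^sup>2 - (p - q) = 2 * a * x" using pq by simp
    ultimately have "2 * k x \<ge> (p - q) / p + (a\<^sup>2 - (p - q)) / q" unfolding k by simp
    moreover have "(p - q) / p + (a\<^sup>2 - (p - q)) / q = a\<^sup>2 / q - (p - q)\<^sup>2 / (p * q)"
    proof -
      have 1: "(p - q) / p = (p - q) * q / (p * q)" and 2: "(p - q) / q = (p - q) * p / (p * q)"
        using p q by simp_all
      have "(p - q)\<^sup>2 / (p * q) = (p - q) * p / (p * q) - (p - q) * q / (p * q)"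
        by (simp only: diff_divide_distrib[symmetric] right_diff_distrib[symmetric] power2_eq_square)
      hence 3: "(p - q)\<^sup>2 / (p * q) = (p - q) / q - (p - q) / p"
        by (simp only: 1[symmetric] 2[symmetric])
      show ?thesis unfolding 3 diff_divide_distrib[of "a\<^sup>2"] by linarith
    qed
    ultimately have low: "2 * k x \<ge> a\<^sup>2 / q - (p - q)\<^sup>2 / (p * q)" by linarith
    have "(p - q)\<^sup>2 = a\<^sup>2 * (a - 2 * x)\<^sup>2" unfolding pq by (simp add: power2_eq_square algebra_simps)
    also have "(a - 2 * x)\<^sup>2 \<le> 2 * p + 2 * q"
    proof -
      have "2 * p + 2 * q - (a - 2 * x)\<^sup>2 = a\<^sup>2 + 4"
        by (simp add: p_def q_def power2_eq_square algebra_simps)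
      moreover have "a\<^sup>2 \<ge> 0" by simp
      ultimately show ?thesis by linarith
    qed
    hence "a\<^sup>2 * (a - 2 * x)\<^sup>2 \<le> a\<^sup>2 * (2 * p + 2 * q)" by (intro mult_left_mono) auto
    finally have "(p - q)\<^sup>2 / (p * q) \<le> a\<^sup>2 * (2 * p + 2 * q) / (p * q)"
      using p q by (intro divide_right_mono) auto
    also have "\<dots> = 2 * a\<^sup>2 / q + 2 * a\<^sup>2 / p"
      using p q by (simp add: add_divide_distrib distrib_left mult.assoc, simp add: mult.commute)
    finally have "2 * k x \<ge> a\<^sup>2 / q - (2 * a\<^sup>2 / q + 2 * a\<^sup>2 / p)" using low by linarith
    moreover have "a\<^sup>2 / q \<ge> 0" "a\<^sup>2 / p \<ge> 0" using p q by auto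
    ultimately have "\<bar>k x\<bar> \<le> 2 * (a\<^sup>2 / q) + 2 * (a\<^sup>2 / p)"
      using up by (simp add: abs_le_iff)
    thus ?thesis by (simp add: p_def q_def)
  qed
  have cont: "isCont k x" for x
    unfolding k_def using pos(1)[of x a] pos(2)[of x] by (auto intro!: continuous_intros)
  have meas: "k \<in> borel_measurable lborel"
    using cont by (simp add: borel_measurable_continuous_onI continuous_at_imp_continuous_on)
  have "integrable lborel (\<lambda>x. 2 * a\<^sup>2 * (1 / (x\<^sup>2 + 1)) + 2 * a\<^sup>2 * (1 / ((x - a)\<^sup>2 + 1)))"
    by (intro Bochner_Integration.integrable_add integrable_mult_right int1 int2)
  then have int: "integrable lborel k"
    by (rule Bochner_Integration.integrable_bound[OF _ meas])
      (auto intro!: AE_I2 intro: order_trans[OF bound] simp del: times_divide_eq_right)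
  have F': "(F has_real_derivative k x) (at x)" for x
  proof -
    define p where "p = (x - a)\<^sup>2 + 1"
    define q where "q = x\<^sup>2 + 1"
    have pq: "p > 0" "q > 0" using pos by (auto simp: p_def q_def)
    have 1: "((\<lambda>x. (x - a) * ln ((x - a)\<^sup>2 + 1)) has_real_derivative
        ln p + 2 * (x - a)\<^sup>2 / p) (at x)"
      unfolding p_def using pos(1)[of x a]
      by (auto intro!: derivative_eq_intros simp: power2_eq_square)
    have 2: "((\<lambda>x. ln (x\<^sup>2 + 1)) has_real_derivative 2 * x / q) (at x)"
      unfolding q_def using pos(2)[of x]
      by (auto intro!: derivative_eq_intros)
    have 3: "((\<lambda>x. arctan (x - a)) has_real_derivative 1 / p) (at x)"
      by (auto intro!: derivative_eq_intros simp: p_def field_simps)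
    have 4: "(arctan has_real_derivative 1 / q) (at x)"
      by (auto intro!: derivative_eq_intros simp: q_def field_simps)
    have "(F has_real_derivative ((ln p + 2 * (x - a)\<^sup>2 / p) - (ln q + 2 * x / q * x)) / 2
        + 1 / p - 1 / q + a / 2 * (2 * x / q)) (at x)"
      unfolding F_def
      using DERIV_add[OF DERIV_diff[OF DERIV_add[OF DERIV_cdivide[OF DERIV_diff[OF 1
              DERIV_mult[OF DERIV_ident 2]], of 2] 3] 4] DERIV_cmult[OF 2, of "a / 2"]]
      by (simp add: q_def)
    moreover have "((ln p + 2 * (x - a)\<^sup>2 / p) - (ln q + 2 * x / q * x)) / 2
        + 1 / p - 1 / q + a / 2 * (2 * x / q)
        = (ln p - ln q) / 2 + ((x - a)\<^sup>2 + 1) / p - (x\<^sup>2 + 1) / q + a * x / q"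
      by (simp add: diff_divide_distrib add_divide_distrib power2_eq_square)
    moreover have "\<dots> = k x" using pq by (simp add: k_def p_def q_def)
    ultimately show ?thesis by simp
  qed
  have top: "(F \<longlongrightarrow> - a) at_top" and bot: "(F \<longlongrightarrow> - a) at_bot"
  proof -
    show "(F \<longlongrightarrow> - a) at_top" unfolding F_def
      by (cases a "0::real" rule: linorder_cases; real_asymp)
    show "(F \<longlongrightarrow> - a) at_bot" unfolding F_def
      by (cases a "0::real" rule: linorder_cases; real_asymp)
  qed
  have "(LBINT x=-\<infinity>..\<infinity>. k x) = (- a) - (- a)"
  proof (rule interval_integral_FTC_integrable[of _ _ F])
    show "(F has_vector_derivative k x) (at x)" for x
      using F' by (simp add: has_real_derivative_iff_has_vector_derivative)
    show "set_integrable lborel (einterval (-\<infinity>) \<infinity>) k" using int by (simp add: set_integrable_def)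
    show "((F \<circ> real_of_ereal) \<longlongrightarrow> - a) (at_right (-\<infinity>))"
      using bot unfolding ereal_tendsto_simps .
    show "((F \<circ> real_of_ereal) \<longlongrightarrow> - a) (at_left \<infinity>)"
      using top unfolding ereal_tendsto_simps .
  qed (use cont in auto)
  hence "integral\<^sup>L lborel k = 0"
    by (simp add: interval_lebesgue_integral_def set_lebesgue_integral_def)
  with int show ?thesis by (simp add: has_bochner_integral_iff k_def)
qed

section \<open>Contributions of the linear factors of a polynomial\<close>

lemma cmod_imaginary_diff: "cmod (\<i> * of_real x - z) = sqrt ((x - Im z)\<^sup>2 + (Re z)\<^sup>2)"
  by (simp add: cmod_def add.commute)

text \<open>The term in \<open>Im z\<close> cancels the \<open>1 / x\<close> part of the integrand at infinity and
  so makes it absolutely integrable on the whole line.\<close>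

lemma has_bochner_integral_ln_linear_factor:
  assumes "Re z \<le> 0"
  shows "has_bochner_integral lborel
    (\<lambda>x. ln (cmod (\<i> * of_real x - z)) - ln (x\<^sup>2 + 1) / 2 + Im z * x / (x\<^sup>2 + 1)) (pi * (- Re z - 1))"
proof -
  let ?a = "Im z"
  \<comment> \<open>Translation by \<open>Im z\<close> centres the comparison at the root; the shift
    lemma then replaces \<open>(x - Im z)\<^sup>2 + 1\<close> by \<open>x\<^sup>2 + 1\<close>
    without changing the integral.\<close>
  have 1: "has_bochner_integral lborel
      (\<lambda>x. (ln ((x - ?a)\<^sup>2 + (- Re z)\<^sup>2) - ln ((x - ?a)\<^sup>2 + 1)) / 2) (pi * (- Re z - 1))"
    using has_bochner_integral_ln_ratio[of "- Re z"] assms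
      lborel_has_bochner_integral_real_affine_iff[of 1
        "\<lambda>x. (ln (x\<^sup>2 + (- Re z)\<^sup>2) - ln (x\<^sup>2 + 1)) / 2" _ "- ?a"] by simp
  from has_bochner_integral_add[OF this has_bochner_integral_ln_shift[of ?a]]
  show ?thesis
    by (simp add: cmod_imaginary_diff ln_sqrt add_nonneg_nonneg diff_divide_distrib algebra_simps)
qed

text \<open>Vieta's formula for the top two coefficients. The degree bound is carried along because
  it makes the coefficient above the top vanish in the induction step.\<close>

lemma coeff_prod_linear_factors:
  fixes A :: "'a :: comm_ring_1 multiset"
  shows "coeff (\<Prod>x\<in>#A. [:- x, 1:]) (size A) = 1"
    and "degree (\<Prod>x\<in>#A. [:- x, 1:]) \<le> size A"
    and "A \<noteq> {#} \<Longrightarrow> coeff (\<Prod>x\<in>#A. [:- x, 1:]) (size A - 1) = - sum_mset A"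
proof (induction A)
  case (add x A)
  let ?P = "\<Prod>x\<in>#A. [:- x, 1:]"
  have P: "(\<Prod>x\<in>#add_mset x A. [:- x, 1:]) = Polynomial.smult (- x) ?P + pCons 0 ?P"
    by simp
  have deg: "degree ?P \<le> size A" using add.IH by simp
  have 1: "coeff ?P (size A) = 1" using add.IH by simp
  have "coeff ?P (Suc (size A)) = 0" using deg by (intro coeff_eq_0) simp
  with 1 show "coeff (\<Prod>x\<in>#add_mset x A. [:- x, 1:]) (size (add_mset x A)) = 1"
    unfolding P by simp
  show "degree (\<Prod>x\<in>#add_mset x A. [:- x, 1:]) \<le> size (add_mset x A)"
    unfolding P using deg
    by (intro degree_add_le) (auto intro: order_trans[OF degree_smult_le] order_trans[OF degree_pCons_le])
  show "coeff (\<Prod>x\<in>#add_mset x A. [:- x, 1:]) (size (add_mset x A) - 1) = - sum_mset (add_mset x A)"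
  proof (cases "A = {#}")
    case False
    then obtain n where n: "size A = Suc n" by (cases "size A") auto
    have "coeff ?P n = - sum_mset A" using add.IH False n by simp
    with 1 show ?thesis unfolding P by (simp add: n)
  qed (simp add: P)
qed auto

text \<open>Apart from the logarithms, integrand and value depend on the multiset only through its
  size and sum. For two multisets that agree in both, these terms cancel.\<close>

lemma has_bochner_integral_ln_linear_factors:
  assumes "\<And>z. z \<in># A \<Longrightarrow> Re z \<le> 0"
  shows "has_bochner_integral lborel
    (\<lambda>x. (\<Sum>z\<in>#A. ln (cmod (\<i> * of_real x - z))) - real (size A) * (ln (x\<^sup>2 + 1) / 2)
       + Im (sum_mset A) * (x / (x\<^sup>2 + 1))) (- pi * (Re (sum_mset A) + real (size A)))"
  using assms
proof (induction A)
  case (add z A)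
  have "Re z \<le> 0" using add.prems by simp
  have eq: "pi * (- Re z - 1) + - pi * (Re (sum_mset A) + real (size A))
      = - pi * (Re (sum_mset (add_mset z A)) + real (size (add_mset z A)))"
    by (simp add: algebra_simps)
  from has_bochner_integral_add[OF has_bochner_integral_ln_linear_factor[OF \<open>Re z \<le> 0\<close>] add.IH] add.prems
  show ?case unfolding eq by (simp add: algebra_simps add_divide_distrib)
qed (simp add: has_bochner_integral_zero)

lemma ln_cmod_poly_linear_factors:
  assumes "poly (\<Prod>x\<in>#A. [:- x, 1:]) s \<noteq> 0"
  shows "ln (cmod (poly (\<Prod>x\<in>#A. [:- x, 1:]) s)) = (\<Sum>z\<in>#A. ln (cmod (s - z)))"
  using assms
proof (induction A)
  case (add z A)
  then show ?case by (simp add: norm_mult ln_mult del: mult_pCons_left)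
qed simp

text \<open>Two polynomials with the same two leading coefficients have equally many roots with the
  same sum, so the contributions of the linear factors cancel.\<close>

lemma bode_integral_complex_poly:
  fixes p q :: "complex poly"
  assumes "p \<noteq> 0" "q \<noteq> 0"
    and p: "\<And>s. poly p s = 0 \<Longrightarrow> Re s \<le> 0" and q: "\<And>s. poly q s = 0 \<Longrightarrow> Re s \<le> 0"
    and deg: "degree (p - q) + 2 \<le> degree q"
  shows "has_bochner_integral lborel
    (\<lambda>x. ln (cmod (poly p (\<i> * of_real x) / poly q (\<i> * of_real x)))) 0"
proof -
  have "degree (p - q) < degree q" using deg by simp
  from degree_add_eq_right[OF this] have deg_eq: "degree p = degree q" by simp
  obtain n where n: "degree q = Suc n" "degree p = Suc n" using deg deg_eq by (cases "degree q") auto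
  \<comment> \<open>The degree of \<open>q\<close> is \<open>n + 1\<close> and that of
    \<open>p - q\<close> at most \<open>n - 1\<close>.\<close>
  have coeff_eq: "coeff p i = coeff q i" if "i \<ge> n" for i
  proof -
    have "coeff (p - q) i = 0" using deg n that by (intro coeff_eq_0) simp
    thus ?thesis by simp
  qed
  obtain A where A: "size A = degree p" "p = Polynomial.smult (lead_coeff p) (\<Prod>x\<in>#A. [:- x, 1:])"
    using alg_closed_imp_factorization[OF \<open>p \<noteq> 0\<close>] by blast
  obtain B where B: "size B = degree q" "q = Polynomial.smult (lead_coeff q) (\<Prod>x\<in>#B. [:- x, 1:])"
    using alg_closed_imp_factorization[OF \<open>q \<noteq> 0\<close>] by blast
  define c where "c = lead_coeff q"
  have lead: "lead_coeff p = c" using coeff_eq[of "Suc n"] n by (simp add: c_def)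
  have "c \<noteq> 0" using \<open>q \<noteq> 0\<close> by (simp add: c_def)
  define P where "P = (\<Prod>x\<in>#A. [:- x, 1:])"
  define Q where "Q = (\<Prod>x\<in>#B. [:- x, 1:])"
  have pP: "p = Polynomial.smult c P" and qQ: "q = Polynomial.smult c Q"
    using A B lead by (simp_all add: P_def Q_def c_def)
  have "A \<noteq> {#}" "B \<noteq> {#}" using A B n by auto
  from coeff_prod_linear_factors(3)[OF this(1)] coeff_prod_linear_factors(3)[OF this(2)]
  have "sum_mset A = sum_mset B"
    using coeff_eq[of n] A(1) B(1) n \<open>c \<noteq> 0\<close> by (simp add: pP qQ P_def Q_def)
  moreover have "size A = size B" using A B n by simp
  moreover have "Re z \<le> 0" if "z \<in># A" for z
    using p[of z] that by (auto simp: pP P_def poly_prod_mset)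
  moreover have "Re z \<le> 0" if "z \<in># B" for z
    using q[of z] that by (auto simp: qQ Q_def poly_prod_mset)
  ultimately have *: "has_bochner_integral lborel
      (\<lambda>x. (\<Sum>z\<in>#A. ln (cmod (\<i> * of_real x - z))) - (\<Sum>z\<in>#B. ln (cmod (\<i> * of_real x - z)))) 0"
    using has_bochner_integral_diff[OF has_bochner_integral_ln_linear_factors[of A]
        has_bochner_integral_ln_linear_factors[of B]] by simp
  \<comment> \<open>Zeros on the imaginary axis are permitted. The logarithm of the quotient need
    not split there, but they form a null set.\<close>
  have "finite {x::real. poly p (\<i> * of_real x) = 0 \<or> poly q (\<i> * of_real x) = 0}"
  proof -
    have "finite {s. poly (p * q) s = 0}" using assms by (intro poly_roots_finite) auto
    moreover have "inj (\<lambda>x::real. \<i> * of_real x)" by (auto simp: inj_on_def)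
    ultimately have "finite ((\<lambda>x::real. \<i> * of_real x) -` {s. poly (p * q) s = 0})"
      by (rule finite_vimageI)
    thus ?thesis by (simp add: vimage_def)
  qed
  hence "{x::real. poly p (\<i> * of_real x) = 0 \<or> poly q (\<i> * of_real x) = 0} \<in> null_sets lborel"
    by (rule finite_imp_null_set_lborel)
  then have ae: "AE x in lborel. ln (cmod (poly p (\<i> * of_real x) / poly q (\<i> * of_real x))) =
      (\<Sum>z\<in>#A. ln (cmod (\<i> * of_real x - z))) - (\<Sum>z\<in>#B. ln (cmod (\<i> * of_real x - z)))"
  proof (rule AE_I'[OF _ subsetI], goal_cases)
    case (1 x)
    show ?case
    proof (rule CollectI, rule ccontr)
      assume "\<not> (poly p (\<i> * of_real x) = 0 \<or> poly q (\<i> * of_real x) = 0)"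
      hence nz: "poly P (\<i> * of_real x) \<noteq> 0" "poly Q (\<i> * of_real x) \<noteq> 0" by (auto simp: pP qQ)
      have "ln (cmod (poly p (\<i> * of_real x) / poly q (\<i> * of_real x)))
          = ln (cmod (poly P (\<i> * of_real x)) / cmod (poly Q (\<i> * of_real x)))"
        using \<open>c \<noteq> 0\<close> by (simp add: pP qQ norm_divide)
      also have "\<dots> = ln (cmod (poly P (\<i> * of_real x))) - ln (cmod (poly Q (\<i> * of_real x)))"
        using nz by (simp add: ln_div)
      finally show False
        using 1 ln_cmod_poly_linear_factors nz by (simp add: P_def Q_def)
    qed
  qed
  have [measurable]: "(\<lambda>x::real. poly r (\<i> * of_real x)) \<in> borel_measurable borel" for r :: "complex poly"
    by (intro borel_measurable_continuous_onI continuous_intros)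
  have "(\<lambda>x::real. ln (cmod (poly p (\<i> * of_real x) / poly q (\<i> * of_real x)))) \<in> borel_measurable lborel"
    by measurable
  with * ae show ?thesis
    by (subst has_bochner_integral_cong_AE) (auto simp: has_bochner_integral_iff)
qed

section \<open>Real polynomials and the integral over the half line\<close>

abbreviation rpoly :: "real poly \<Rightarrow> complex \<Rightarrow> complex" where
  "rpoly p s \<equiv> poly (map_poly of_real p) s"

lemma cnj_rpoly: "rpoly p (cnj s) = cnj (rpoly p s)"
  by (induction p) (auto simp: Polynomial.map_poly_pCons)

text \<open>Real coefficients make \<open>f\<close> even, so the integral over the whole line, which
  is zero, is twice the one over the half line.\<close>

lemma bode_integral:
  fixes p q :: "real poly"
  defines "f \<equiv> (\<lambda>x. ln (cmod (rpoly p (\<i> * of_real x) / rpoly q (\<i> * of_real x))))"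
  assumes "p \<noteq> 0" "q \<noteq> 0"
    and "\<And>s. rpoly p s = 0 \<Longrightarrow> Re s \<le> 0"
    and "\<And>s. rpoly q s = 0 \<Longrightarrow> Re s \<le> 0"
    and deg: "degree (p - q) + 2 \<le> degree q"
  shows "set_integrable lborel {0..} f" "(LBINT x:{0..}. f x) = 0"
proof -
  have "map_poly complex_of_real p - map_poly of_real q = map_poly of_real (p - q)"
    by (intro poly_eqI) (simp add: coeff_map_poly)
  hence f: "has_bochner_integral lborel f 0"
    unfolding f_def using assms
    by (intro bode_integral_complex_poly) (auto simp: degree_map_poly map_poly_eq_0_iff)
  hence int: "integrable lborel f" by (simp add: has_bochner_integral_iff)
  then show si: "set_integrable lborel {0..} f"
    unfolding set_integrable_def by (intro integrable_mult_indicator) auto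
  have even: "f (- x) = f x" for x
  proof -
    have "\<i> * of_real (- x) = cnj (\<i> * of_real x)" by simp
    thus ?thesis unfolding f_def by (simp only: cnj_rpoly complex_cnj_divide[symmetric] complex_mod_cnj)
  qed
  define I where "I = (LBINT x:{0..}. f x)"
  have 1: "has_bochner_integral lborel (\<lambda>x. indicator {0..} x *\<^sub>R f x) I"
    using si by (simp add: I_def set_integrable_def set_lebesgue_integral_def has_bochner_integral_iff)
  have "has_bochner_integral lborel (\<lambda>x. indicator {0..} (0 + (-1) * x) *\<^sub>R f (0 + (-1) * x)) (I /\<^sub>R \<bar>-1\<bar>)"
    using 1 by (subst lborel_has_bochner_integral_real_affine_iff[symmetric]) auto
  from has_bochner_integral_add[OF 1 this]
  have 2: "has_bochner_integral lborel
      (\<lambda>x. indicator {0..} x *\<^sub>R f x + indicator {0..} (- x) *\<^sub>R f x) (2 * I)"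
    by (simp add: even)
  have "AE x in lborel. indicator {0..} x *\<^sub>R f x + indicator {0..} (- x) *\<^sub>R f x = f x"
    using AE_lborel_singleton[of 0] by eventually_elim (auto simp: indicator_def)
  hence "has_bochner_integral lborel f (2 * I)"
    using 2 int by (subst (asm) has_bochner_integral_cong_AE) (auto simp: has_bochner_integral_iff)
  with f have "2 * I = 0" by (rule has_bochner_integral_eq[rotated])
  thus "(LBINT x:{0..}. f x) = 0" by (simp add: I_def)
qed

section \<open>Factorization of the tridiagonal determinants\<close>

text \<open>With \<open>T\<^sub>k\<close> the \<open>k \<times> k\<close> tridiagonal matrix that has \<open>2\<close> in every diagonal entry and
  \<open>-1\<close> next to the diagonal, \<open>cont_poly x k = det (I + x T\<^sub>k)\<close> and
  \<open>L_det x N = det (I + x L\<^sub>N)\<close> for \<open>N \<ge> 1\<close>.\<close>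

fun cont_poly :: "'a :: comm_ring_1 \<Rightarrow> nat \<Rightarrow> 'a" where
  "cont_poly x 0 = 1"
| "cont_poly x (Suc 0) = 1 + 2 * x"
| "cont_poly x (Suc (Suc k)) = (1 + 2 * x) * cont_poly x (Suc k) - x\<^sup>2 * cont_poly x k"

definition L_det :: "'a :: comm_ring_1 \<Rightarrow> nat \<Rightarrow> 'a" where
  "L_det x N = cont_poly x N - x * cont_poly x (N - 1)"

text \<open>Since \<open>1 + 2 * x = 2 * x * cos \<theta>\<close>, division by \<open>x ^ k\<close>
  turns the recurrence into that of the Chebyshev polynomials of the second kind:
  \<open>cont_poly x k\<close> is \<open>x ^ k\<close> times U_k(cos \<theta>).\<close>

lemma cont_poly_sin:
  fixes x \<theta> :: real
  assumes x: "x * (2 - 2 * cos \<theta>) = - 1"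
  shows "sin \<theta> * cont_poly x k = x ^ k * sin ((real k + 1) * \<theta>)"
proof (induction k rule: induct_nat_012)
  case 1
  have "1 + 2 * x = 2 * x * cos \<theta>" using x by (simp add: algebra_simps)
  moreover have "sin ((real (Suc 0) + 1) * \<theta>) = 2 * sin \<theta> * cos \<theta>" by (simp add: sin_double)
  ultimately show ?case by (simp add: algebra_simps)
next
  case (ge2 k)
  have c: "1 + 2 * x = 2 * x * cos \<theta>" using x by (simp add: algebra_simps)
  have "sin \<theta> * cont_poly x (Suc (Suc k)) =
      2 * x * cos \<theta> * (sin \<theta> * cont_poly x (Suc k)) - x\<^sup>2 * (sin \<theta> * cont_poly x k)"
    by (simp only: cont_poly.simps c right_diff_distrib mult.assoc mult.left_commute)
  also have "\<dots> = x ^ (k + 2) * (2 * cos \<theta> * sin ((real k + 2) * \<theta>) - sin ((real k + 1) * \<theta>))"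
    unfolding ge2 by (simp add: algebra_simps power2_eq_square)
  also have "2 * cos \<theta> * sin ((real k + 2) * \<theta>) =
      sin ((real k + 2) * \<theta> + \<theta>) + sin ((real k + 2) * \<theta> - \<theta>)"
    by (simp add: sin_add sin_diff)
  also have "\<dots> = sin ((real k + 3) * \<theta>) + sin ((real k + 1) * \<theta>)"
    by (simp add: algebra_simps)
  finally show ?case by (simp add: algebra_simps)
qed simp

lemma cont_poly_X:
  "degree (cont_poly [:0, 1 :: real:] k) \<le> k \<and> coeff (cont_poly [:0, 1 :: real:] k) 0 = 1"
proof (induction k rule: induct_nat_012)
  case 1
  have "1 + 2 * [:0, 1 :: real:] = [:1, 2:]" by (simp add: one_pCons numeral_poly)
  then show ?case by simp
next
  case (ge2 k)
  have 1: "1 + 2 * [:0, 1 :: real:] = [:1, 2:]" by (simp add: one_pCons numeral_poly)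
  have 2: "[:0, 1 :: real:]\<^sup>2 = [:0, 0, 1:]" by (simp add: power2_eq_square)
  have "degree ([:1, 2:] * cont_poly [:0, 1 :: real:] (Suc k)) \<le> Suc (Suc k)"
    using degree_mult_le[of "[:1, 2:]" "cont_poly [:0, 1 :: real:] (Suc k)"] ge2 by simp
  note d1 = this
  have d2: "degree ([:0, 0, 1:] * cont_poly [:0, 1 :: real:] k) \<le> Suc (Suc k)"
    using degree_mult_le[of "[:0, 0, 1:]" "cont_poly [:0, 1 :: real:] k"] ge2 by simp
  have eq: "cont_poly [:0, 1 :: real:] (Suc (Suc k))
      = [:1, 2:] * cont_poly [:0, 1:] (Suc k) - [:0, 0, 1:] * cont_poly [:0, 1:] k"
    by (simp only: cont_poly.simps 1 2)
  show ?case unfolding eq using degree_diff_le[OF d1 d2] ge2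
    by (simp del: mult_pCons_left cont_poly.simps add: coeff_mult)
qed simp

text \<open>\<open>N = 0\<close> has to be left out: \<open>N - 1\<close> is then \<open>0\<close>,
  and \<open>L_det x 0\<close> is \<open>1 - x\<close>, which has degree 1 for the
  indeterminate.\<close>

lemma L_det_X:
  assumes "N \<ge> 1"
  shows "degree (L_det [:0, 1 :: real:] N) \<le> N \<and> coeff (L_det [:0, 1 :: real:] N) 0 = 1"
proof -
  obtain n where n: "N = Suc n" using assms by (cases N) auto
  have "degree ([:0, 1:] * cont_poly [:0, 1 :: real:] n) \<le> Suc n"
    using degree_mult_le[of "[:0, 1:]" "cont_poly [:0, 1 :: real:] n"] cont_poly_X[of n] by simp
  with cont_poly_X[of "Suc n"] show ?thesis
    by (auto simp: L_det_def n simp del: mult_pCons_left cont_poly.simps simp add: coeff_mult intro: degree_diff_le)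
qed

lemma poly_cont_poly: "poly (cont_poly p k) x = cont_poly (poly p x) k"
  by (induction k rule: induct_nat_012) simp_all

lemma poly_L_det: "poly (L_det p k) x = L_det (poly p x) k"
  by (simp add: L_det_def poly_cont_poly)

text \<open>Both sides have degree at most \<open>k\<close> and agree at \<open>k + 1\<close>
  points: at \<open>0\<close> and at the common roots \<open>- 1 / c i\<close> with
  \<open>c i = 2 - 2 * cos (\<theta> i)\<close>. The roots are distinct because cosine is injective
  on [0, \<pi>].\<close>

lemma poly_factorization_trig:
  fixes p :: "real poly" and \<theta> :: "nat \<Rightarrow> real"
  assumes deg: "degree p \<le> k" and p0: "coeff p 0 = 1"
    and \<theta>: "\<And>i. i < k \<Longrightarrow> 0 < \<theta> i \<and> \<theta> i < pi" "inj_on \<theta> {..<k}"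
    and root: "\<And>i x. i < k \<Longrightarrow> x * (2 - 2 * cos (\<theta> i)) = - 1 \<Longrightarrow> poly p x = 0"
  shows "\<exists>c. (\<forall>i<k. 0 < c i \<and> c i < 4) \<and> p = (\<Prod>i<k. [:1, c i:])"
proof -
  define c where "c i = 2 - 2 * cos (\<theta> i)" for i
  have cos: "cos (\<theta> i) < 1 \<and> cos (\<theta> i) > -1" if "i < k" for i
  proof -
    have "0 \<le> \<theta> i" "0 < \<theta> i" "\<theta> i < pi" "\<theta> i \<le> pi" using \<theta>(1)[OF that] by auto
    from cos_monotone_0_pi[OF _ this(2,4)] cos_monotone_0_pi[OF this(1,3)]
    show ?thesis by simp
  qed
  have c: "0 < c i \<and> c i < 4" if "i < k" for i using cos[OF that] by (simp add: c_def)
  have inj: "inj_on c {..<k}"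
  proof (rule inj_onI)
    fix i j assume "i \<in> {..<k}" "j \<in> {..<k}" "c i = c j"
    hence "\<theta> i = \<theta> j" using \<theta>(1)[of i] \<theta>(1)[of j] by (intro cos_inj_pi[of "\<theta> i" "\<theta> j"]) (auto simp: c_def)
    thus "i = j" using \<theta>(2) \<open>i \<in> {..<k}\<close> \<open>j \<in> {..<k}\<close> by (auto dest: inj_onD)
  qed
  define R where "R = insert 0 ((\<lambda>i. - 1 / c i) ` {..<k})"
  have "inj_on (\<lambda>i. - 1 / c i) {..<k}"
  proof (rule inj_onI)
    fix i j assume ij: "i \<in> {..<k}" "j \<in> {..<k}" "- 1 / c i = - 1 / c j"
    hence "c i = c j" using c[of i] c[of j] by simp
    with ij inj show "i = j" by (auto dest: inj_onD)
  qed
  moreover have "0 \<notin> (\<lambda>i. - 1 / c i) ` {..<k}" using c by force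
  ultimately have card: "card R = Suc k" by (simp add: R_def card_image)
  have "p = (\<Prod>i<k. [:1, c i:])"
  proof (rule poly_eqI_degree[of R])
    fix x assume "x \<in> R"
    then consider "x = 0" | i where "i < k" "x = - 1 / c i" by (auto simp: R_def)
    thus "poly p x = poly (\<Prod>i<k. [:1, c i:]) x"
    proof cases
      case 1
      thus ?thesis using p0 by (simp add: poly_prod flip: poly_0_coeff_0)
    next
      case 2
      hence "x * c i = - 1" using c[of i] by simp
      hence "poly p x = 0" "1 + x * c i = 0" using root[of i x] 2 by (auto simp: c_def)
      moreover have "poly (\<Prod>i<k. [:1, c i:]) x = 0"
        unfolding poly_prod using 2 \<open>1 + x * c i = 0\<close> by (intro prod_zero) auto
      ultimately show ?thesis by simp
    qed
  next
    show "degree p < card R" using deg card by simp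
    have "degree (\<Prod>i<k. [:1, c i:]) \<le> (\<Sum>i<k. degree [:1, c i:])"
      using degree_prod_sum_le[of "{..<k}" "\<lambda>i. [:1, c i:]"] by (simp add: o_def)
    also have "\<dots> \<le> (\<Sum>i<k. 1)" by (intro sum_mono) simp
    finally show "degree (\<Prod>i<k. [:1, c i:]) < card R" using card by simp
  qed
  with c show ?thesis by blast
qed

lemma cont_poly_factorization:
  "\<exists>c. (\<forall>i<k. 0 < c i \<and> c i < 4) \<and> cont_poly [:0, 1 :: real:] k = (\<Prod>i<k. [:1, c i:])"
proof (rule poly_factorization_trig)
  \<comment> \<open>The zeros of \<open>sin ((k + 1) * \<theta>)\<close> strictly between 0 and
    \<pi>; \<open>Suc i\<close> leaves out the angle 0.\<close>
  let ?\<theta> = "\<lambda>i. real (Suc i) * pi / (real k + 1)"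
  show \<theta>: "0 < ?\<theta> i \<and> ?\<theta> i < pi" if "i < k" for i
    using that by (auto simp: divide_less_eq intro!: divide_pos_pos mult_pos_pos)
  show "inj_on ?\<theta> {..<k}" by (auto simp: inj_on_def)
  fix i x assume i: "i < k" and x: "x * (2 - 2 * cos (?\<theta> i)) = - 1"
  have "(real k + 1) * ?\<theta> i = real (Suc i) * pi" by simp
  hence "sin (?\<theta> i) * cont_poly x k = x ^ k * sin (real (Suc i) * pi)"
    using cont_poly_sin[OF x, of k] by presburger
  hence "sin (?\<theta> i) * cont_poly x k = 0" by (simp only: sin_npi mult_zero_right)
  moreover have "sin (?\<theta> i) > 0" using \<theta>[OF i] by (intro sin_gt_zero) auto
  ultimately show "poly (cont_poly [:0, 1:] k) x = 0" by (simp add: poly_cont_poly)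
qed (use cont_poly_X in auto)

lemma L_det_factorization:
  assumes "N \<ge> 1"
  shows "\<exists>c. (\<forall>i<N. 0 < c i \<and> c i < 4) \<and> L_det [:0, 1 :: real:] N = (\<Prod>i<N. [:1, c i:])"
proof (rule poly_factorization_trig)
  \<comment> \<open>Up to a power of \<open>x\<close>, \<open>sin \<theta> * L_det x N\<close> is
    \<open>sin ((N + 1) * \<theta>) - sin (N * \<theta>) = 2 * sin (\<theta> / 2) * cos ((2 * N + 1)
    * \<theta> / 2)\<close>. These angles are the zeros of the cosine factor between 0 and
    \<pi>.\<close>
  let ?\<theta> = "\<lambda>i. (2 * real i + 1) * pi / (2 * real N + 1)"
  obtain n where n: "N = Suc n" using assms by (cases N) auto
  show \<theta>: "0 < ?\<theta> i \<and> ?\<theta> i < pi" if "i < N" for i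
    using that by (auto simp: divide_less_eq intro!: divide_pos_pos mult_pos_pos)
  show "inj_on ?\<theta> {..<N}" using assms by (auto simp: inj_on_def)
  fix i x assume i: "i < N" and x: "x * (2 - 2 * cos (?\<theta> i)) = - 1"
  let ?t = "?\<theta> i"
  have "(2 * real N + 1) * ?t / 2 = real i * pi + pi / 2" by (simp add: field_simps)
  hence c0: "cos ((2 * real N + 1) * ?t / 2) = 0" by (simp add: cos_add)
  have "sin ?t * L_det x N = x ^ N * sin ((real N + 1) * ?t) - x * (x ^ n * sin (real N * ?t))"
  proof -
    have "real n + 1 = real N" by (simp add: n)
    with cont_poly_sin[OF x, of n] have "sin ?t * cont_poly x n = x ^ n * sin (real N * ?t)"
      by presburger
    moreover have "sin ?t * L_det x N = sin ?t * cont_poly x N - x * (sin ?t * cont_poly x n)"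
      by (simp add: L_det_def n right_diff_distrib mult.left_commute del: cont_poly.simps)
    ultimately show ?thesis by (simp only: cont_poly_sin[OF x, of N])
  qed
  also have "\<dots> = x ^ N * (sin ((real N + 1) * ?t) - sin (real N * ?t))"
    by (simp add: n algebra_simps)
  also have "sin ((real N + 1) * ?t) - sin (real N * ?t)
      = 2 * sin (((real N + 1) * ?t - real N * ?t) / 2) * cos (((real N + 1) * ?t + real N * ?t) / 2)"
    by (rule sin_diff_sin)
  also have "((real N + 1) * ?t + real N * ?t) / 2 = (2 * real N + 1) * ?t / 2"
    by (simp only: distrib_right[symmetric]) simp
  finally have "sin ?t * L_det x N = 0" unfolding c0 by simp
  moreover have "sin ?t > 0" using \<theta>[OF i] by (intro sin_gt_zero) auto
  ultimately show "poly (L_det [:0, 1:] N) x = 0" by (simp add: poly_L_det)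
qed (use L_det_X assms in auto)

section \<open>Inverting the loop matrix\<close>

text \<open>This is \<open>I + x L_N\<close> with explicit entries, over any commutative ring. The
  corner is \<open>1 + x\<close> because the first column of \<open>B_mat\<close> has a single
  nonzero entry.\<close>

definition tri_mat :: "'a :: comm_ring_1 \<Rightarrow> nat \<Rightarrow> 'a mat" where
  "tri_mat x N = Matrix.mat N N (\<lambda>(i, j).
     if i = j then 1 + (if i = 0 then x else 2 * x) else if j = Suc i \<or> i = Suc j then - x else 0)"

lemma tri_mat_carrier [simp]: "tri_mat x N \<in> carrier_mat N N"
  by (simp add: tri_mat_def)

lemma transpose_tri_mat: "transpose_mat (tri_mat x N) = tri_mat x N"
  by (rule eq_matI) (auto simp: tri_mat_def)

lemma dim_L_mat [simp]: "dim_row (L_mat N) = N" "dim_col (L_mat N) = N"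
  by (simp_all add: L_mat_def B_mat_def)

lemma L_mat_index:
  assumes "i < N" "j < N"
  shows "L_mat N $$ (i, j) =
    (if i = j then if i = 0 then 1 else 2 else if j = Suc i \<or> i = Suc j then - 1 else 0)"
proof -
  let ?b = "\<lambda>i j. if i = j then 1 else if j = Suc i then - 1 else 0 :: real"
  have "L_mat N $$ (i, j) = (\<Sum>k<N. ?b k i * ?b k j)"
    using assms by (simp add: L_mat_def B_mat_def scalar_prod_def lessThan_atLeast0)
  also have "\<dots> = (\<Sum>k<N. (if k = i then ?b i j else 0) - (if Suc k = i then ?b k j else 0))"
    by (intro sum.cong) auto
  also have "\<dots> = ?b i j - (\<Sum>k<N. if Suc k = i then ?b k j else 0)"
    using assms by (simp add: sum_subtractf)
  also have "(\<Sum>k<N. if Suc k = i then ?b k j else 0) = (if i = 0 then 0 else ?b (i - 1) j)"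
  proof (cases i)
    case (Suc m)
    have "(\<Sum>k<N. if Suc k = i then ?b k j else 0) = (\<Sum>k<N. if k = m then ?b m j else 0)"
      by (intro sum.cong) (auto simp: Suc)
    thus ?thesis using assms Suc by simp
  qed simp
  finally show ?thesis by auto
qed

lemma ratfun_const_add: "ratfun_const (a + b) = ratfun_const a + ratfun_const b"
  by (simp add: ratfun_const_def flip: to_fract_add)

lemma ratfun_const_mult: "ratfun_const (a * b) = ratfun_const a * ratfun_const b"
  by (simp add: ratfun_const_def flip: to_fract_mult)

lemma ratfun_const_0 [simp]: "ratfun_const 0 = 0"
  by (simp add: ratfun_const_def)

lemma ratfun_const_1 [simp]: "ratfun_const 1 = 1"
  by (simp add: ratfun_const_def flip: one_pCons)

lemma ratfun_const_2 [simp]: "ratfun_const 2 = 2"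
  using ratfun_const_add[of 1 1] by simp

lemma ratfun_const_minus_1 [simp]: "ratfun_const (- 1) = - 1"
  using ratfun_const_add[of 1 "- 1"] by (simp add: add_eq_0_iff)

lemma loop_mat_eq_tri_mat: "loop_mat P C N = tri_mat (P * C) N"
  by (rule eq_matI) (auto simp: loop_mat_def tri_mat_def L_mat_index)

lemma tri_mat_mult_vec:
  assumes v: "v \<in> carrier_vec N" and i: "i < N"
  shows "(tri_mat x N *\<^sub>v v) $ i =
    (1 + (if i = 0 then x else 2 * x)) * v $ i - x * (if Suc i < N then v $ Suc i else 0)
      - x * (if i = 0 then 0 else v $ (i - 1))"
proof -
  have "(tri_mat x N *\<^sub>v v) $ i = (\<Sum>j<N. tri_mat x N $$ (i, j) * v $ j)"
    using assms by (simp add: scalar_prod_def tri_mat_def lessThan_atLeast0)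
  also have "\<dots> = (\<Sum>j<N. (if j = i then (1 + (if i = 0 then x else 2 * x)) * v $ i else 0)
      - (if j = Suc i then x * v $ Suc i else 0) - (if Suc j = i then x * v $ j else 0))"
    using i by (intro sum.cong) (auto simp: tri_mat_def)
  also have "\<dots> = (1 + (if i = 0 then x else 2 * x)) * v $ i
      - x * (if Suc i < N then v $ Suc i else 0) - (\<Sum>j<N. if Suc j = i then x * v $ j else 0)"
    using i by (simp add: sum_subtractf)
  also have "(\<Sum>j<N. if Suc j = i then x * v $ j else 0) = x * (if i = 0 then 0 else v $ (i - 1))"
  proof (cases i)
    case (Suc m)
    have "(\<Sum>j<N. if Suc j = i then x * v $ j else 0) = (\<Sum>j<N. if j = m then x * v $ m else 0)"
      by (intro sum.cong) (auto simp: Suc)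
    thus ?thesis using i Suc by simp
  qed simp
  finally show ?thesis .
qed

lemma L_det_Suc_Suc: "L_det x (Suc (Suc n)) = (1 + x) * cont_poly x (Suc n) - x\<^sup>2 * cont_poly x n"
  by (simp add: L_det_def algebra_simps)

text \<open>Cramer's rule: deleting row 0 and column \<open>i\<close> leaves \<open>i\<close>
  off-diagonal entries and a trailing block of size \<open>N - 1 - i\<close>, so the cofactor is
  \<open>x ^ i * cont_poly x (N - 1 - i)\<close>. Row 0 then yields \<open>L_det\<close>; the other
  rows vanish by the recurrence and its initial values.\<close>

lemma tri_mat_first_column:
  fixes x :: "'a :: field"
  assumes N: "N \<ge> 1" and det: "L_det x N \<noteq> 0"
  defines "u \<equiv> Matrix.vec N (\<lambda>i. x ^ i * cont_poly x (N - 1 - i) / L_det x N)"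
  shows "tri_mat x N *\<^sub>v u = unit_vec N 0"
proof (rule eq_vecI)
  fix i assume "i < dim_vec (unit_vec N 0)"
  hence i: "i < N" by simp
  have u: "u \<in> carrier_vec N" by (simp add: u_def)
  define d where "d = L_det x N"
  show "(tri_mat x N *\<^sub>v u) $ i = unit_vec N 0 $ i"
  proof (cases i)
    case 0
    show ?thesis
    proof (cases "N = 1")
      case True
      have "L_det x (Suc 0) = 1 + x" by (simp add: L_det_def)
      then show ?thesis unfolding tri_mat_mult_vec[OF u i] using 0 i det
        by (simp add: u_def True)
    next
      case False
      with N obtain n where n: "N = Suc (Suc n)" by (cases N; cases "N - 1") auto
      have "d = (1 + x) * cont_poly x (Suc n) - x\<^sup>2 * cont_poly x n"
        by (simp add: d_def n L_det_Suc_Suc del: cont_poly.simps)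
      moreover have "(1 + x) * (cont_poly x (Suc n) / d) - x * (x * cont_poly x n / d)
          = ((1 + x) * cont_poly x (Suc n) - x\<^sup>2 * cont_poly x n) / d"
        by (simp add: diff_divide_distrib power2_eq_square mult.assoc del: cont_poly.simps)
      ultimately show ?thesis unfolding tri_mat_mult_vec[OF u i] using 0 i det
        by (simp add: u_def n d_def[unfolded n, symmetric] del: cont_poly.simps)
    qed
  next
    case (Suc m)
    show ?thesis
    proof (cases "Suc i < N")
      case False
      hence "N = Suc (Suc m)" using i Suc by simp
      thus ?thesis unfolding tri_mat_mult_vec[OF u i] using Suc i
        by (simp add: u_def algebra_simps)
    next
      case True
      define k where "k = N - Suc (Suc (Suc m))"
      have N: "N = k + Suc (Suc (Suc m))" using True Suc by (simp add: k_def)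
      have "u $ i = x ^ Suc m * cont_poly x (Suc k) / d" "u $ Suc i = x ^ Suc (Suc m) * cont_poly x k / d"
        "u $ m = x ^ m * cont_poly x (Suc (Suc k)) / d"
        using Suc by (simp_all add: u_def d_def N del: cont_poly.simps power_Suc)
      hence "(1 + 2 * x) * u $ i - x * u $ Suc i - x * u $ m =
          ((1 + 2 * x) * (x ^ Suc m * cont_poly x (Suc k)) - x * (x ^ Suc (Suc m) * cont_poly x k)
            - x * (x ^ m * cont_poly x (Suc (Suc k)))) / d"
        by (simp only: times_divide_eq_right diff_divide_distrib)
      also have "\<dots> = 0"
        by (simp add: algebra_simps power2_eq_square)
      finally show ?thesis unfolding tri_mat_mult_vec[OF u i] using Suc i True by simp
    qed
  qed
qed (simp add: tri_mat_def)

lemma tri_mat_kernel: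
  fixes x :: "'a :: field"
  assumes N: "N \<ge> 1" and det: "L_det x N \<noteq> 0"
    and v: "v \<in> carrier_vec N" and ker: "tri_mat x N *\<^sub>v v = 0\<^sub>v N"
  shows "v = 0\<^sub>v N"
proof -
  define u where "u = Matrix.vec N (\<lambda>i. x ^ i * cont_poly x (N - 1 - i) / L_det x N)"
  have u: "u \<in> carrier_vec N" by (simp add: u_def)
  \<comment> \<open>The matrix is symmetric and its range contains the first unit vector, so kernel vectors
    vanish at \<open>0\<close>; the rows then determine the other entries successively.\<close>
  have "unit_vec N 0 \<bullet> v = (transpose_mat (tri_mat x N) *\<^sub>v u) \<bullet> v"
    using tri_mat_first_column[OF N det] by (simp add: transpose_tri_mat u_def)
  also have "\<dots> = u \<bullet> (tri_mat x N *\<^sub>v v)"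
    using u v by (intro transpose_vec_mult_scalar) auto
  also have "\<dots> = 0" using u by (simp add: ker)
  finally have v0: "v $ 0 = 0" using v N by simp
  have row: "(1 + (if i = 0 then x else 2 * x)) * v $ i - x * (if Suc i < N then v $ Suc i else 0)
      - x * (if i = 0 then 0 else v $ (i - 1)) = 0" if "i < N" for i
    using tri_mat_mult_vec[OF v that, of x] that by (simp add: ker)
  have "v $ i = 0" if "i < N" for i
  \<comment> \<open>For \<open>x = 0\<close> the rows decouple; otherwise row \<open>i - 1\<close>
    is solved for \<open>v $ i\<close>, dividing by \<open>x\<close>.\<close>
  proof (cases "x = 0")
    case True
    thus ?thesis using row[OF that] by (auto split: if_splits)
  next
    case False
    show ?thesis using that
    proof (induction i rule: less_induct)
      case (less i)
      show ?case
      proof (cases i)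
        case (Suc m)
        with less have "v $ m = 0" "m \<noteq> 0 \<longrightarrow> v $ (m - 1) = 0" by auto
        thus ?thesis using row[of m] less.prems Suc False by (auto split: if_splits)
      qed (use v0 in simp)
    qed
  qed
  thus ?thesis using v by (intro eq_vecI) auto
qed

text \<open>The trivial kernel gives a nonzero determinant without computing it. Applying the
  inverse to the equation in \<open>tri_mat_first_column\<close> identifies its first
  column.\<close>

lemma loop_mat_inverse:
  assumes N: "N \<ge> 1" and det: "L_det (P * C) N \<noteq> 0"
  shows "invertible_mat (loop_mat P C N)"
    and "S_fun P C N = cont_poly (P * C) (N - 1) / L_det (P * C) N"
proof -
  define M where "M = tri_mat (P * C) N"
  have M: "M \<in> carrier_mat N N" by (simp add: M_def)
  have "Determinant.det M \<noteq> 0"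
    using det_0_iff_vec_prod_zero_field[OF M] tri_mat_kernel[OF N det] by (auto simp: M_def)
  from det_non_zero_imp_unit[OF M this, of "()"] mat_inverse(1)[OF M, where b = "()"]
  obtain W where W: "mat_inverse M = Some W" by (cases "mat_inverse M") auto
  from mat_inverse(2)[OF M W] have W': "M * W = 1\<^sub>m N" "W * M = 1\<^sub>m N" "W \<in> carrier_mat N N" by auto
  show "invertible_mat (loop_mat P C N)"
    using W' M by (auto simp: invertible_mat_def inverts_mat_def loop_mat_eq_tri_mat simp flip: M_def)
  define u where "u = Matrix.vec N (\<lambda>i. (P * C) ^ i * cont_poly (P * C) (N - 1 - i) / L_det (P * C) N)"
  have u: "u \<in> carrier_vec N" by (simp add: u_def)
  have "W *\<^sub>v unit_vec N 0 = W *\<^sub>v (M *\<^sub>v u)"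
    using tri_mat_first_column[OF N det] by (simp add: M_def u_def)
  also have "\<dots> = (W * M) *\<^sub>v u" using W' M u by (intro assoc_mult_mat_vec[symmetric]) auto
  also have "\<dots> = u" using W' u by simp
  finally have "(W *\<^sub>v unit_vec N 0) $ 0 = u $ 0" by simp
  moreover have "(W *\<^sub>v unit_vec N 0) $ 0 = W $$ (0, 0)" using W' N by simp
  ultimately show "S_fun P C N = cont_poly (P * C) (N - 1) / L_det (P * C) N"
    using N W by (simp add: S_fun_def loop_mat_eq_tri_mat u_def flip: M_def)
qed

section \<open>Real rational functions on the right half plane\<close>

text \<open>Used with \<open>ratfun_const\<close> to carry factorizations over to rational
  functions, and with \<open>of_real\<close> to evaluate real polynomials at complex points.\<close>

lemma comm_ring_hom_poly_map_poly:
  assumes "comm_ring_hom h"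
  shows "comm_ring_hom (\<lambda>p. poly (map_poly h p) x)"
proof -
  interpret map_poly_comm_ring_hom h using assms by (rule map_poly_comm_ring_hom.intro)
  show ?thesis by unfold_locales (simp_all add: hom_distribs)
qed

lemma cont_poly_hom:
  assumes "comm_ring_hom h"
  shows "h (cont_poly x k) = cont_poly (h x) k"
proof -
  interpret comm_ring_hom h by fact
  have "h 2 = 2" using hom_add[of 1 1] by simp
  thus ?thesis
    by (induction k rule: induct_nat_012) (simp_all add: hom_add hom_mult hom_minus hom_power)
qed

lemma comm_ring_hom_ratfun_const: "comm_ring_hom ratfun_const"
  by unfold_locales (simp_all add: ratfun_const_add ratfun_const_mult)

lemma cont_poly_ratfun:
  assumes "cont_poly [:0, 1:] k = (\<Prod>i<m. [:1, c i:])"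
  shows "cont_poly G k = (\<Prod>i<m. 1 + ratfun_const (c i) * G)"
proof -
  define h where "h = (\<lambda>p. poly (map_poly ratfun_const p) G)"
  have hom: "comm_ring_hom h"
    unfolding h_def by (intro comm_ring_hom_poly_map_poly comm_ring_hom_ratfun_const)
  interpret comm_ring_hom h by fact
  have "h [:0, 1:] = G" "h [:1, c:] = 1 + ratfun_const c * G" for c
    by (simp_all add: h_def Polynomial.map_poly_pCons mult.commute)
  thus ?thesis using cont_poly_hom[OF hom, of "[:0, 1:]" k] by (simp add: assms hom_prod)
qed

lemma L_det_ratfun:
  assumes "L_det [:0, 1:] N = (\<Prod>i<m. [:1, c i:])"
  shows "L_det G N = (\<Prod>i<m. 1 + ratfun_const (c i) * G)"
proof -
  define h where "h = (\<lambda>p. poly (map_poly ratfun_const p) G)"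
  have hom: "comm_ring_hom h"
    unfolding h_def by (intro comm_ring_hom_poly_map_poly comm_ring_hom_ratfun_const)
  interpret comm_ring_hom h by fact
  have 1: "h [:0, 1:] = G" and 2: "h [:1, c:] = 1 + ratfun_const c * G" for c
    by (simp_all add: h_def Polynomial.map_poly_pCons mult.commute)
  have "L_det G N = h (L_det [:0, 1:] N)"
    by (simp add: L_det_def hom_minus hom_mult cont_poly_hom[OF hom] 1 del: mult_pCons_left)
  thus ?thesis by (simp add: assms hom_prod 2)
qed

lemma comm_ring_hom_rpoly: "comm_ring_hom (\<lambda>p. rpoly p s)"
  by (intro comm_ring_hom_poly_map_poly) unfold_locales

lemma rpoly_mult: "rpoly (p * q) s = rpoly p s * rpoly q s"
proof -
  interpret comm_ring_hom "\<lambda>p. rpoly p s" by (rule comm_ring_hom_rpoly)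
  show ?thesis by (rule hom_mult)
qed

lemma rpoly_add: "rpoly (p + q) s = rpoly p s + rpoly q s"
proof -
  interpret comm_ring_hom "\<lambda>p. rpoly p s" by (rule comm_ring_hom_rpoly)
  show ?thesis by (rule hom_add)
qed

lemma rpoly_prod: "rpoly (\<Prod>i\<in>I. f i) s = (\<Prod>i\<in>I. rpoly (f i) s)"
proof -
  interpret comm_ring_hom "\<lambda>p. rpoly p s" by (rule comm_ring_hom_rpoly)
  show ?thesis by (rule hom_prod)
qed

lemma rpoly_smult: "rpoly (Polynomial.smult c p) s = of_real c * rpoly p s"
  using rpoly_mult[of "[:c:]" p s] by (simp add: Polynomial.map_poly_pCons)

text \<open>The reduced denominator divides the denominator \<open>b\<close> of any other
  representation, hence does not vanish at \<open>s\<close> either, and cross multiplication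
  applies.\<close>

lemma ratfun_eval_eq:
  assumes f: "f * to_fract b = to_fract a" and b: "rpoly b s \<noteq> 0"
  shows "ratfun_eval f s = rpoly a s / rpoly b s"
proof -
  let ?n = "ratfun_num f" and ?d = "ratfun_denom f"
  have d0: "?d \<noteq> 0" by simp
  have "f = to_fract ?n / to_fract ?d"
    using Fract_quot_of_fract[of f] by (simp only: Fract_conv_to_fract)
  moreover have "to_fract ?d \<noteq> 0" by (metis d0 to_fract_eq_0_iff)
  ultimately have "f * to_fract ?d = to_fract ?n" by (metis nonzero_divide_eq_eq)
  hence "to_fract (?n * b) = to_fract (a * ?d)"
    using f by (simp flip: f)
  hence eq: "?n * b = a * ?d" by (simp only: to_fract_eq_iff)
  hence "?d dvd ?n * b" by simp
  hence "?d dvd b"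
    using coprime_quot_of_fract[of f] by (simp add: coprime_dvd_mult_right_iff coprime_commute)
  then obtain c where "b = ?d * c" by (rule dvdE)
  hence "rpoly ?d s \<noteq> 0" using b by (auto simp: rpoly_mult)
  moreover have "rpoly ?n s * rpoly b s = rpoly a s * rpoly ?d s"
    using arg_cong[OF eq, of "\<lambda>p. rpoly p s"] by (simp only: rpoly_mult)
  ultimately show ?thesis using b by (simp add: ratfun_eval_def field_simps)
qed

section \<open>Closure properties of the Hardy space\<close>

lemma Hinf_const: "(\<lambda>s. c) \<in> Hinf"
  by (auto simp: Hinf_def analytic_on_const intro: bounded_subset[of "{c}"])

lemma Hinf_add:
  assumes "f \<in> Hinf" "g \<in> Hinf"
  shows "(\<lambda>s. f s + g s) \<in> Hinf"
  using assms unfolding Hinf_def by (auto intro!: analytic_on_add bounded_plus_comp)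

lemma Hinf_mult:
  assumes "f \<in> Hinf" "g \<in> Hinf"
  shows "(\<lambda>s. f s * g s) \<in> Hinf"
proof -
  from assms obtain A B where AB: "\<And>s. Re s > 0 \<Longrightarrow> cmod (f s) \<le> A" "\<And>s. Re s > 0 \<Longrightarrow> cmod (g s) \<le> B"
    unfolding Hinf_def bounded_iff by auto
  have "cmod (f s * g s) \<le> A * B" if "Re s > 0" for s
    unfolding norm_mult using AB[OF that]
    by (intro mult_mono) (auto intro: order_trans[OF norm_ge_zero])
  hence "bounded ((\<lambda>s. f s * g s) ` {s. Re s > 0})" unfolding bounded_iff by auto
  thus ?thesis using assms unfolding Hinf_def by (auto intro!: analytic_on_mult)
qed

lemma Hinf_prod:
  assumes "\<And>i. i \<in> I \<Longrightarrow> f i \<in> Hinf"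
  shows "(\<lambda>s. \<Prod>i\<in>I. f i s) \<in> Hinf"
  using assms by (induction I rule: infinite_finite_induct) (auto intro: Hinf_const Hinf_mult)

text \<open>Analyticity on a set refers to neighbourhoods; as the half plane is open, agreement
  inside it suffices.\<close>

lemma Hinf_cong:
  assumes "f \<in> Hinf" "\<And>s. Re s > 0 \<Longrightarrow> f s = g s"
  shows "g \<in> Hinf"
proof -
  have "open {s. Re s > 0}" by (rule open_halfspace_Re_gt)
  hence "f analytic_on {s. Re s > 0} \<longleftrightarrow> g analytic_on {s. Re s > 0}"
    using assms(2) by (auto simp: analytic_on_open elim: holomorphic_transform)
  moreover have "f ` {s. Re s > 0} = g ` {s. Re s > 0}" using assms(2) by (intro image_cong) auto
  ultimately show ?thesis using assms(1) by (simp add: Hinf_def)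
qed

text \<open>Every root \<open>z\<close> satisfies |s - z| \<ge> Re (s - z) \<ge> Re s.\<close>

lemma cmod_poly_ge_half_plane:
  fixes q :: "complex poly"
  assumes roots: "\<And>z. poly q z = 0 \<Longrightarrow> Re z \<le> 0" and s: "Re s > 0"
  shows "cmod (lead_coeff q) * Re s ^ degree q \<le> cmod (poly q s)"
proof (cases "q = 0")
  case False
  then obtain A where A: "size A = degree q" "q = Polynomial.smult (lead_coeff q) (\<Prod>x\<in>#A. [:- x, 1:])"
    using alg_closed_imp_factorization[of q] by blast
  have "poly q z = lead_coeff q * poly (\<Prod>x\<in>#A. [:- x, 1:]) z" for z
    by (subst A(2)) simp
  moreover from this have "\<And>z. z \<in># A \<Longrightarrow> Re z \<le> 0"
    by (intro roots) (auto simp: poly_prod_mset)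
  hence "Re s ^ size A \<le> cmod (poly (\<Prod>x\<in>#A. [:- x, 1:]) s)"
  proof (induction A)
    case (add z A)
    have "Re s \<le> Re (s - z)" using add.prems[of z] by simp
    also have "\<dots> \<le> cmod (s - z)" by (rule complex_Re_le_cmod)
    finally have "Re s * Re s ^ size A \<le> cmod (s - z) * cmod (poly (\<Prod>x\<in>#A. [:- x, 1:]) s)"
      using add s by (intro mult_mono) auto
    thus ?case by (simp add: norm_mult del: mult_pCons_left)
  qed simp
  ultimately show ?thesis using A(1) by (simp add: norm_mult mult_left_mono)
qed simp

text \<open>The inequality holds at \<open>s + t\<close> for small real t > 0 and survives t
  \<rightarrow> 0. This carries a bound on the open half plane over to the imaginary axis.\<close>

lemma rpoly_eq_0_bounded_quotient:
  assumes "q \<noteq> 0" and s: "Re s \<ge> 0" and q: "rpoly q s = 0"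
    and bound: "\<And>z. Re z > 0 \<Longrightarrow> rpoly q z \<noteq> 0 \<Longrightarrow> cmod (rpoly p z) \<le> M * cmod (rpoly q z)"
  shows "rpoly p s = 0"
proof -
  let ?\<gamma> = "\<lambda>t. s + of_real t"
  have "finite {z. rpoly q z = 0}"
    using \<open>q \<noteq> 0\<close> by (intro poly_roots_finite) (simp add: map_poly_eq_0_iff)
  moreover have "inj ?\<gamma>" by (auto simp: inj_on_def)
  ultimately have "finite (?\<gamma> -` {z. rpoly q z = 0})" by (rule finite_vimageI)
  hence fin: "finite {t::real. rpoly q (?\<gamma> t) = 0}" by (simp add: vimage_def)
  \<comment> \<open>Removing 0 from the finite zero set makes its complement an open neighbourhood
    of 0.\<close>
  hence "open (- ({t::real. rpoly q (?\<gamma> t) = 0} - {0}))"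
    by (intro open_Compl finite_imp_closed) auto
  hence "\<forall>\<^sub>F t in at_right 0. t \<in> - ({t::real. rpoly q (?\<gamma> t) = 0} - {0})"
    by (auto simp: eventually_at_topological)
  hence "\<forall>\<^sub>F t in at_right 0. cmod (rpoly p (?\<gamma> t)) \<le> M * cmod (rpoly q (?\<gamma> t))"
    using eventually_at_right_less[of 0]
  proof eventually_elim
    case (elim t)
    thus ?case using s by (intro bound) auto
  qed
  moreover have "((\<lambda>t. cmod (rpoly p (?\<gamma> t))) \<longlongrightarrow> cmod (rpoly p (?\<gamma> 0))) (at_right 0)"
    "((\<lambda>t. M * cmod (rpoly q (?\<gamma> t))) \<longlongrightarrow> M * cmod (rpoly q (?\<gamma> 0))) (at_right 0)"
    by (intro tendsto_intros)+
  ultimately have "cmod (rpoly p (?\<gamma> 0)) \<le> M * cmod (rpoly q (?\<gamma> 0))"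
    by (intro tendsto_le[OF trivial_limit_at_right_real])
  thus ?thesis using q by simp
qed

text \<open>In the expanded product every term other than \<open>d ^ N\<close> has a factor
  \<open>d\<close> replaced by a multiple of \<open>n\<close>, which lowers the degree by at least
  2.\<close>

lemma prod_add_smult_near_power:
  fixes n d :: "'a :: field poly"
  assumes deg: "degree n + 2 \<le> degree d" and N: "N \<ge> 1"
  shows "degree ((\<Prod>i<N. d + Polynomial.smult (c i) n) - d ^ N) + 2 \<le> N * degree d"
  using N
proof (induction N rule: nat_induct_at_least)
  case base
  show ?case using deg degree_smult_le[of "c 0" n] by simp
next
  case (Suc N)
  let ?P = "\<Prod>i<N. d + Polynomial.smult (c i) n"
  let ?r = "?P - d ^ N"
  have "(\<Prod>i<Suc N. d + Polynomial.smult (c i) n) - d ^ Suc N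
      = ?r * (d + Polynomial.smult (c N) n) + d ^ N * Polynomial.smult (c N) n"
    by (simp add: algebra_simps)
  moreover have "degree (d + Polynomial.smult (c N) n) \<le> degree d"
    using deg degree_smult_le[of "c N" n] by (intro degree_add_le) auto
  hence "degree (?r * (d + Polynomial.smult (c N) n)) \<le> Suc N * degree d - 2"
    using degree_mult_le[of ?r "d + Polynomial.smult (c N) n"] Suc.IH by simp
  moreover have "degree (d ^ N * Polynomial.smult (c N) n) \<le> Suc N * degree d - 2"
    using degree_mult_le[of "d ^ N" "Polynomial.smult (c N) n"] degree_power_le[of d N]
      degree_smult_le[of "c N" n] deg by (simp add: mult.commute)
  ultimately have "degree ((\<Prod>i<Suc N. d + Polynomial.smult (c i) n) - d ^ Suc N) \<le> Suc N * degree d - 2"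
    by (simp add: degree_add_le del: prod.lessThan_Suc mult_Suc)
  thus ?case using deg by simp
qed

theorem theorem2:
  fixes P C :: real_ratfun
  assumes "\<forall>k\<in>{0<..<4::real}. 1 + ratfun_const k * (P * C) \<noteq> 0 \<and>
             ratfun_eval (1 / (1 + ratfun_const k * (P * C))) \<in> Hinf"
  shows "(\<forall>N\<ge>1. invertible_mat (loop_mat P C N) \<and> ratfun_eval (S_fun P C N) \<in> Hinf) \<and>
         (degree (ratfun_denom (P * C)) \<ge> degree (ratfun_num (P * C)) + 2 \<longrightarrow>
            (\<forall>N\<ge>1. set_integrable lborel {0..} (\<lambda>\<omega>::real. ln (cmod (ratfun_eval (S_fun P C N) (\<i> * of_real \<omega>)))) \<and>
               (LBINT \<omega>:{0..}. ln (cmod (ratfun_eval (S_fun P C N) (\<i> * of_real \<omega>)))) = 0))"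
proof -
  define G where "G = P * C"
  define n where "n = ratfun_num G"
  define d where "d = ratfun_denom G"
  define e where "e = (\<lambda>k. d + Polynomial.smult k n)"
  have d0: "d \<noteq> 0" by (simp add: d_def)
  have G: "G = to_fract n / to_fract d"
    using Fract_quot_of_fract[of G] by (simp only: Fract_conv_to_fract n_def d_def)
  have cop: "coprime n d" unfolding n_def d_def by (rule coprime_quot_of_fract)
  have one_plus: "1 + ratfun_const k * G = to_fract (e k) / to_fract d" for k
  proof -
    have "to_fract (Polynomial.smult k n) = ratfun_const k * to_fract n"
      by (simp add: ratfun_const_def flip: to_fract_mult)
    thus ?thesis using d0 by (simp add: e_def G field_simps)
  qed
  have e0: "e k \<noteq> 0" if "0 < k" "k < 4" for k
    using assms that one_plus[of k] by (force simp flip: G_def)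
  have rpoly_e: "rpoly (e k) s = rpoly d s + of_real k * rpoly n s" for k s
    by (simp add: e_def rpoly_add rpoly_smult)
  have eval: "ratfun_eval (1 / (1 + ratfun_const k * G)) s = rpoly d s / rpoly (e k) s"
    if "0 < k" "k < 4" "rpoly (e k) s \<noteq> 0" for k s
    using that e0[of k] d0 by (intro ratfun_eval_eq) (auto simp: one_plus)
  \<comment> \<open>Boundedness of \<open>d / e k\<close> forces a zero of \<open>e k\<close> in the
    closed right half plane to be a zero of \<open>d\<close>, hence of \<open>n\<close> as
    \<open>k\<close> is nonzero. This contradicts the Bezout identity.\<close>
  have e_stable: "rpoly (e k) s \<noteq> 0" if k: "0 < k" "k < 4" and s: "Re s \<ge> 0" for k s
  proof
    assume es: "rpoly (e k) s = 0"
    have "ratfun_eval (1 / (1 + ratfun_const k * G)) \<in> Hinf" using assms k by (simp add: G_def)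
    then obtain M where M: "\<And>z. Re z > 0 \<Longrightarrow> cmod (ratfun_eval (1 / (1 + ratfun_const k * G)) z) \<le> M"
      unfolding Hinf_def bounded_iff by auto
    have "rpoly d s = 0"
    proof (rule rpoly_eq_0_bounded_quotient[OF e0[OF k] s es])
      fix z assume z: "Re z > 0" "rpoly (e k) z \<noteq> 0"
      show "cmod (rpoly d z) \<le> M * cmod (rpoly (e k) z)"
        using M[OF z(1), unfolded eval[OF k z(2)]] z(2) by (simp add: norm_divide field_simps)
    qed
    moreover from this have "rpoly n s = 0" using es k by (simp add: rpoly_e)
    moreover obtain a b where "a * n + b * d = 1"
      using cop bezout_coefficients_fst_snd[of n d] by (metis coprime_iff_gcd_eq_1)
    hence "rpoly (a * n + b * d) s = 1" by simp
    ultimately show False by (simp add: rpoly_add rpoly_mult)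
  qed
  have e_nz: "to_fract (e k) \<noteq> 0" if "0 < k" "k < 4" for k using e0[OF that] by simp
  have main: "\<exists>a b. (\<forall>i<N. 0 \<le> a i \<and> a i < 4) \<and> (\<forall>i<N. 0 < b i \<and> b i < 4) \<and>
      invertible_mat (loop_mat P C N) \<and>
      S_fun P C N * to_fract (\<Prod>i<N. e (b i)) = to_fract (\<Prod>i<N. e (a i))" if N: "N \<ge> 1" for N
  proof -
    obtain m where m: "N = Suc m" using N by (cases N) auto
    obtain a where a: "\<And>i. i < m \<Longrightarrow> 0 < a i \<and> a i < 4" "cont_poly [:0, 1 :: real:] m = (\<Prod>i<m. [:1, a i:])"
      using cont_poly_factorization[of m] by blast
    obtain b where b: "\<And>i. i < N \<Longrightarrow> 0 < b i \<and> b i < 4" "L_det [:0, 1 :: real:] N = (\<Prod>i<N. [:1, b i:])"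
      using L_det_factorization[OF N] by blast
    \<comment> \<open>The numerator has one factor less; the padding \<open>a' m = 0\<close> contributes \<open>e 0 = d\<close>.\<close>
    define a' where "a' = (\<lambda>i. if i < m then a i else 0)"
    have to_fract_prod: "to_fract (\<Prod>i<N. f i) = (\<Prod>i<N. to_fract (f i))" for f :: "nat \<Rightarrow> real poly"
      by (induction N) simp_all
    have num: "cont_poly G m = (\<Prod>i<N. to_fract (e (a' i)) / to_fract d)"
      using cont_poly_ratfun[OF a(2), of G] by (simp add: m a'_def flip: one_plus)
    have den: "L_det G N = (\<Prod>i<N. to_fract (e (b i)) / to_fract d)"
      using L_det_ratfun[OF b(2), of G] by (simp flip: one_plus)
    \<comment> \<open>Here the hypothesis that \<open>1 + k P C\<close> is not the zero function
      makes the loop matrix invertible.\<close>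
    have nz: "L_det G N \<noteq> 0" using e_nz b d0 by (auto simp: den)
    have prod_nz: "(\<Prod>i<N. to_fract (e (b i))) \<noteq> 0" using e_nz b by auto
    have "S_fun P C N = cont_poly G m / L_det G N"
      using loop_mat_inverse(2)[OF N] nz by (simp add: G_def m)
    also have "\<dots> = (\<Prod>i<N. to_fract (e (a' i))) / (\<Prod>i<N. to_fract (e (b i)))"
      using d0 by (simp add: num den prod_dividef)
    finally have "S_fun P C N * to_fract (\<Prod>i<N. e (b i)) = to_fract (\<Prod>i<N. e (a' i))"
      using prod_nz by (simp add: to_fract_prod)
    moreover have "invertible_mat (loop_mat P C N)"
      using loop_mat_inverse(1)[OF N] nz by (simp add: G_def)
    moreover have "\<forall>i<N. 0 \<le> a' i \<and> a' i < 4" using a(1) by (auto simp: a'_def less_imp_le)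
    ultimately show ?thesis using b(1) by blast
  qed
  have Hinf: "ratfun_eval (S_fun P C N) \<in> Hinf" if N: "N \<ge> 1" for N
  proof -
    obtain a b where ab: "\<And>i. i < N \<Longrightarrow> 0 < b i \<and> b i < 4"
        "S_fun P C N * to_fract (\<Prod>i<N. e (b i)) = to_fract (\<Prod>i<N. e (a i))"
      using main[OF N] by blast
    let ?T = "\<lambda>k. ratfun_eval (1 / (1 + ratfun_const k * G))"
    \<comment> \<open>Being affine in \<open>?T (b i)\<close>, each factor falls under the closure
      rules although \<open>G\<close> itself may be unbounded.\<close>
    let ?f = "\<lambda>i s. of_real (a i / b i) + of_real (1 - a i / b i) * ?T (b i) s"
    have "?f i \<in> Hinf" if "i < N" for i
      using assms ab(1)[OF that] by (intro Hinf_add Hinf_mult Hinf_const) (auto simp: G_def)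
    hence "(\<lambda>s. \<Prod>i<N. ?f i s) \<in> Hinf" by (intro Hinf_prod) auto
    moreover have "(\<Prod>i<N. ?f i s) = ratfun_eval (S_fun P C N) s" if s: "Re s > 0" for s
    proof -
      have nz: "rpoly (e (b i)) s \<noteq> 0" if "i < N" for i using ab(1)[OF that] s by (intro e_stable) auto
      have "?f i s = rpoly (e (a i)) s / rpoly (e (b i)) s" if "i < N" for i
      proof -
        have b: "0 < b i" "b i < 4" using ab(1)[OF that] by auto
        have "?f i s = (of_real (a i / b i) * rpoly (e (b i)) s + of_real (1 - a i / b i) * rpoly d s)
            / rpoly (e (b i)) s"
          unfolding eval[OF b nz[OF that]] using nz[OF that] by (simp add: add_divide_distrib)
        also have "of_real (a i / b i) * rpoly (e (b i)) s + of_real (1 - a i / b i) * rpoly d s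
            = rpoly (e (a i)) s"
          using b(1) by (simp add: rpoly_e field_simps)
        finally show ?thesis .
      qed
      moreover have "ratfun_eval (S_fun P C N) s = rpoly (\<Prod>i<N. e (a i)) s / rpoly (\<Prod>i<N. e (b i)) s"
        using nz by (intro ratfun_eval_eq ab) (auto simp: rpoly_prod)
      ultimately show ?thesis by (simp add: rpoly_prod prod_dividef)
    qed
    ultimately show ?thesis by (rule Hinf_cong)
  qed
  have bode: "set_integrable lborel {0..} (\<lambda>\<omega>::real. ln (cmod (ratfun_eval (S_fun P C N) (\<i> * of_real \<omega>)))) \<and>
      (LBINT \<omega>:{0..}. ln (cmod (ratfun_eval (S_fun P C N) (\<i> * of_real \<omega>)))) = 0"
    if deg: "degree d \<ge> degree n + 2" and N: "N \<ge> 1" for N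
  proof -
    obtain a b where ab: "\<And>i. i < N \<Longrightarrow> 0 \<le> a i \<and> a i < 4" "\<And>i. i < N \<Longrightarrow> 0 < b i \<and> b i < 4"
        "S_fun P C N * to_fract (\<Prod>i<N. e (b i)) = to_fract (\<Prod>i<N. e (a i))"
      using main[OF N] by blast
    have deg_smult: "degree (Polynomial.smult k n) < degree d" for k
      using deg degree_smult_le[of k n] by simp
    \<comment> \<open>As \<open>n\<close> has smaller degree than \<open>d\<close>, adding a
      multiple of it leaves the leading term unchanged, for every real \<open>k\<close>.\<close>
    have deg_e: "degree (e k) = degree d" and lead_e: "lead_coeff (e k) = lead_coeff d" for k
      using degree_add_eq_left[OF deg_smult[of k]] lead_coeff_add_le[OF deg_smult[of k]]
      by (simp_all add: e_def add.commute)
    have e0': "e k \<noteq> 0" for k using lead_e[of k] d0 by auto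
    \<comment> \<open>The lower bound from \<open>cmod_poly_ge_half_plane\<close> for \<open>e k\<close> is uniform in \<open>k\<close>,
      so it survives \<open>k \<rightarrow> 0\<close>.\<close>
    have d_stable: "rpoly d s \<noteq> 0" if s: "Re s > 0" for s
    proof -
      have "\<bar>lead_coeff d\<bar> * Re s ^ degree d \<le> cmod (rpoly (e k) s)" if k: "0 < k" "k < 4" for k
      proof -
        have "Re z \<le> 0" if "rpoly (e k) z = 0" for z
          using e_stable[OF k, of z] that by (meson linear)
        from cmod_poly_ge_half_plane[of "map_poly of_real (e k)", OF this s] show ?thesis
          using lead_e[of k] deg_e[of k] by (simp add: degree_map_poly coeff_map_poly)
      qed
      moreover have "\<forall>\<^sub>F k::real in at_right 0. 0 < k \<and> k < 4"
        using eventually_at_right_real[of 0 "4::real"] by simp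
      ultimately have "\<forall>\<^sub>F k in at_right 0. \<bar>lead_coeff d\<bar> * Re s ^ degree d \<le> cmod (rpoly (e k) s)"
        by (auto elim: eventually_mono)
      moreover have "((\<lambda>k. cmod (rpoly (e k) s)) \<longlongrightarrow> cmod (rpoly d s + of_real 0 * rpoly n s)) (at_right 0)"
        unfolding rpoly_e by (intro tendsto_intros)
      ultimately have "\<bar>lead_coeff d\<bar> * Re s ^ degree d \<le> cmod (rpoly d s + of_real 0 * rpoly n s)"
        by (intro tendsto_lowerbound[OF _ _ trivial_limit_at_right_real])
      moreover have "\<bar>lead_coeff d\<bar> * Re s ^ degree d > 0" using d0 s by simp
      ultimately show ?thesis by auto
    qed
    \<comment> \<open>The padding index gives \<open>e 0 = d\<close>, which may have zeros on the
      imaginary axis; only the open half plane is claimed.\<close>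
    have e_stable': "rpoly (e k) s \<noteq> 0" if "0 \<le> k" "k < 4" "Re s > 0" for k s
      using e_stable[of k s] d_stable[of s] that by (cases "k = 0") (auto simp: e_def)
    let ?p = "\<Prod>i<N. e (a i)" and ?q = "\<Prod>i<N. e (b i)"
    have q_nz: "rpoly ?q s \<noteq> 0" if "Re s \<ge> 0" for s
      using that ab(2) e_stable by (auto simp: rpoly_prod)
    have eval_S: "ratfun_eval (S_fun P C N) (\<i> * of_real \<omega>)
        = rpoly ?p (\<i> * of_real \<omega>) / rpoly ?q (\<i> * of_real \<omega>)" for \<omega> :: real
      by (intro ratfun_eval_eq ab q_nz) simp
    \<comment> \<open>Comparing both products with \<open>d ^ N\<close> shows that their top two
      coefficients agree.\<close>
    have "degree ((?p - d ^ N) - (?q - d ^ N)) + 2 \<le> N * degree d"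
    proof -
      have "degree ((?p - d ^ N) - (?q - d ^ N)) \<le> N * degree d - 2"
        unfolding e_def
        using prod_add_smult_near_power[OF deg N, of a] prod_add_smult_near_power[OF deg N, of b]
        by - (rule degree_diff_le, simp_all)
      moreover have "2 \<le> N * degree d"
        using prod_add_smult_near_power[OF deg N, of a] by simp
      ultimately show ?thesis by simp
    qed
    moreover have "degree ?q = N * degree d"
      using e0' by (subst degree_prod_eq_sum_degree) (auto simp: deg_e)
    ultimately have "degree (?p - ?q) + 2 \<le> degree ?q" by simp
    moreover have "Re s \<le> 0" if "rpoly ?p s = 0" for s
      using that ab(1) e_stable' by (force simp: rpoly_prod not_le[symmetric])
    moreover have "Re s \<le> 0" if "rpoly ?q s = 0" for s
      using that q_nz[of s] by fastforce
    moreover have "?p \<noteq> 0" "?q \<noteq> 0" using e0' by auto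
    ultimately show ?thesis unfolding eval_S using bode_integral[of ?p ?q] by blast
  qed
  show ?thesis using main Hinf bode by (force simp: G_def n_def d_def)
qed

end
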